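(* Let $A:\mathbb{R}\to\mathbb{C}^{p\times p}$ be an almost periodic matrix, let $P$ be a constant projection matrix ($P^2=P$) that commutes with $\Phi_A(t)$ for every $t\in\mathbb{R}$, and suppose that for some given positive constants $c$ and $\alpha$ the inequality $$\|\Psi_A(t,s)P\|\le c\exp(-\alpha|t-s|)$$ is satisfied for all $(t,s)\in\mathbb{R}^2$ with $t>s$ (or, alternatively, for all $(t,s)\in\mathbb{R}^2$ with $t<s$). Then there exist two real constants $c_1>0$ and $\alpha'\in\,]0,\alpha[$ such that for all $(t,s,\xi)\in\mathbb{R}^3$ with $t>s$ (respectively, with $t<s$) $$\|\Psi_A(t+\xi,s+\xi)P-\Psi_A(t,s)P\|\le c_1\|A(\cdot+\xi)-A(\cdot)\|_\infty\exp(-\alpha'|t-s|).$$ In particular, if $\xi$ is an $\epsilon$-almost period of $A$, the inequality $$\|\Psi_A(t+\xi,s+\xi)P-\Psi_A(t,s)P\|\le c_1\,\epsilon\exp(-\alpha'|t-s|)$$ is satisfied for all $(t,s)\in\mathbb{R}^2$ with $t>s$ (respectively, $t<s$); that is, $\Psi_A(t,s)P$ is Bi-almost periodic.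
   Context: $\Phi_A(t)$ denotes a fundamental matrix of the linear system $y'=A(t)y$, and $\Psi_A(t,s)=\Phi_A(t)\Phi_A^{-1}(s)$. $A$ is (Bohr) almost periodic if it is bounded and continuous and for each $\epsilon>0$ there is $l_\epsilon>0$ such that every interval of length $l_\epsilon$ contains an $\epsilon$-almost period $\xi$ of $A$, i.e. a number $\xi$ with $\|A(t+\xi)-A(t)\|\le\epsilon$ for all $t\in\mathbb{R}$. $\|\cdot\|_\infty$ is the sup norm over $\mathbb{R}$. "Bi-almost periodic" is used here as a name for the last displayed property (for every $\epsilon$-almost period $\xi$ of $A$). *)

theory Defs
  imports "HOL-Analysis.Analysis"
begin

text \<open>
  The matrix norm is a parameter \<open>N\<close>: an arbitrary norm on the complex vector space of
  \<open>p\<close> by \<open>p\<close> matrices. Submultiplicativity is not required, so operator norms, the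
  Frobenius norm and entrywise norms are all instances.
\<close>

definition is_matrix_norm :: "(complex^'p^'p \<Rightarrow> real) \<Rightarrow> bool" where
  "is_matrix_norm N \<longleftrightarrow>
     (\<forall>X. N X = 0 \<longleftrightarrow> X = 0) \<and>
     (\<forall>c X. N (\<chi> i j. c * X $ i $ j) = cmod c * N X) \<and>
     (\<forall>X Y. N (X + Y) \<le> N X + N Y)"

text \<open>The supremum is taken in the reals, so it is meaningful only for bounded \<open>f\<close>.\<close>

definition sup_norm ::
    "(complex^'p^'p \<Rightarrow> real) \<Rightarrow> (real \<Rightarrow> complex^'p^'p) \<Rightarrow> real" where
  "sup_norm N f = (SUP t. N (f t))"

definition almost_period ::
    "(complex^'p^'p \<Rightarrow> real) \<Rightarrow> (real \<Rightarrow> complex^'p^'p) \<Rightarrow> real \<Rightarrow> real \<Rightarrow> bool" where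
  "almost_period N A \<epsilon> \<xi> \<longleftrightarrow> (\<forall>t. N (A (t + \<xi>) - A t) \<le> \<epsilon>)"

text \<open>
  Boundedness and continuity refer to the standard topology of the matrix space; as the space
  is finite-dimensional, they do not depend on the choice of \<open>N\<close>.
\<close>

definition almost_periodic ::
    "(complex^'p^'p \<Rightarrow> real) \<Rightarrow> (real \<Rightarrow> complex^'p^'p) \<Rightarrow> bool" where
  "almost_periodic N A \<longleftrightarrow>
     bounded (range A) \<and> continuous_on UNIV A \<and>
     (\<forall>\<epsilon>>0. \<exists>l>0. \<forall>a. \<exists>\<xi>\<in>{a..a + l}. almost_period N A \<epsilon> \<xi>)"

definition fundamental_matrix ::
    "(real \<Rightarrow> complex^'p^'p) \<Rightarrow> (real \<Rightarrow> complex^'p^'p) \<Rightarrow> bool" where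
  "fundamental_matrix A \<Phi> \<longleftrightarrow>
     (\<forall>t. (\<Phi> has_vector_derivative (A t ** \<Phi> t)) (at t)) \<and> (\<forall>t. invertible (\<Phi> t))"

definition transition_matrix ::
    "(real \<Rightarrow> complex^'p^'p) \<Rightarrow> real \<Rightarrow> real \<Rightarrow> complex^'p^'p" where
  "transition_matrix \<Phi> t s = \<Phi> t ** matrix_inv (\<Phi> s)"

text \<open>
  Bi-almost periodicity of a kernel \<open>K\<close> on a region \<open>D\<close> of the plane, relative to the
  almost periods of \<open>A\<close> and with explicit constants \<open>c\<close> and \<open>\<beta>\<close>.
\<close>

definition bi_almost_periodic ::
    "(complex^'p^'p \<Rightarrow> real) \<Rightarrow> (real \<Rightarrow> complex^'p^'p) \<Rightarrow> (real \<times> real) set \<Rightarrow> real \<Rightarrow> real \<Rightarrow>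
     (real \<Rightarrow> real \<Rightarrow> complex^'p^'p) \<Rightarrow> bool" where
  "bi_almost_periodic N A D c \<beta> K \<longleftrightarrow>
     (\<forall>\<epsilon>>0. \<forall>\<xi>. almost_period N A \<epsilon> \<xi> \<longrightarrow>
        (\<forall>(t, s)\<in>D. N (K (t + \<xi>) (s + \<xi>) - K t s) \<le> c * \<epsilon> * exp (- \<beta> * \<bar>t - s\<bar>)))"

end

theory Submission
  imports Defs
begin

text \<open>
  Along \<open>\<tau>\<close> from \<open>s\<close> to \<open>t\<close>, the matrix \<open>\<Psi>(t, \<tau>) P \<Psi>(\<tau> + \<xi>, s + \<xi>) P\<close> moves from
  \<open>\<Psi>(t, s) P\<close> to \<open>\<Psi>(t + \<xi>, s + \<xi>) P\<close>, and its derivative is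
  \<open>\<Psi>(t, \<tau>) P (A(\<tau> + \<xi>) - A(\<tau>)) \<Psi>(\<tau> + \<xi>, s + \<xi>) P\<close>. The hypothesis bounds this by a multiple
  of \<open>\<parallel>A(\<cdot> + \<xi>) - A(\<cdot>)\<parallel> exp(-\<alpha>\<bar>t - s\<bar>)\<close>, so the mean value inequality gives the claim up to a
  factor \<open>\<bar>t - s\<bar>\<close>, which is absorbed by lowering \<open>\<alpha>\<close> to \<open>\<alpha>/2\<close>.
\<close>

section \<open>Equivalence of norms\<close>

text \<open>\<open>N\<close> is convex, hence continuous in finite dimension, so it attains a
  maximum and a minimum on the compact unit sphere. The minimum is positive by definiteness, and
  homogeneity carries both bounds to all vectors.\<close>

lemma norm_equiv_euclidean:
  fixes N :: "'a::euclidean_space \<Rightarrow> real"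
  assumes zero: "\<And>x. N x = 0 \<longleftrightarrow> x = 0"
    and scale: "\<And>r x. N (r *\<^sub>R x) = \<bar>r\<bar> * N x"
    and tri: "\<And>x y. N (x + y) \<le> N x + N y"
  obtains K L where "K > 0" "L > 0" "\<And>x. N x \<le> K * norm x" "\<And>x. norm x \<le> L * N x"
proof -
  \<comment> \<open>0 = N (x - x) \<le> 2 * N x.\<close>
  have nonneg: "0 \<le> N x" for x
    using tri[of x "- 1 *\<^sub>R x"] scale[of "- 1" x] zero[of 0] by simp
  have "convex_on UNIV N"
  proof (rule convex_onI)
    fix t :: real and x y :: 'a
    assume "0 < t" "t < 1"
    then show "N ((1 - t) *\<^sub>R x + t *\<^sub>R y) \<le> (1 - t) * N x + t * N y"
      using tri[of "(1 - t) *\<^sub>R x" "t *\<^sub>R y"] by (simp add: scale)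
  qed simp
  then have "continuous_on UNIV N"
    by (rule convex_on_continuous[OF open_UNIV])
  then have cont: "continuous_on (sphere 0 1) N"
    by (rule continuous_on_subset) simp
  have ne: "sphere (0::'a) 1 \<noteq> {}"
    by simp
  obtain u where u: "u \<in> sphere 0 1" "\<And>x. x \<in> sphere 0 1 \<Longrightarrow> N x \<le> N u"
    using continuous_attains_sup[OF compact_sphere ne cont] by blast
  obtain v where v: "v \<in> sphere 0 1" "\<And>x. x \<in> sphere 0 1 \<Longrightarrow> N v \<le> N x"
    using continuous_attains_inf[OF compact_sphere ne cont] by blast
  have "u \<noteq> 0" "v \<noteq> 0"
    using u(1) v(1) by auto
  then have pos: "N u > 0" "N v > 0"
    using zero[of u] zero[of v] nonneg[of u] nonneg[of v] by linarith+
  have N_eq: "N x = norm x * N (sgn x)" for x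
    using scale[of "norm x" "sgn x"] zero[of x] by (cases "x = 0") (simp_all add: sgn_div_norm)
  have sgn: "sgn x \<in> sphere 0 1" if "x \<noteq> 0" for x :: 'a
    using that by (simp add: norm_sgn)
  show ?thesis
  proof (rule that[of "N u" "1 / N v"])
    fix x
    show "N x \<le> N u * norm x"
      using u(2)[OF sgn, of x] N_eq[of x] mult_left_mono[of "N (sgn x)" "N u" "norm x"]
      by (cases "x = 0") (simp_all add: mult.commute)
    show "norm x \<le> 1 / N v * N x"
      using v(2)[OF sgn, of x] N_eq[of x] mult_left_mono[of "N v" "N (sgn x)" "norm x"] pos
      by (cases "x = 0") (simp_all add: pos_le_divide_eq nonneg)
  qed (use pos in auto)
qed

text \<open>As \<open>N\<close> may fail to be submultiplicative, products are estimated in the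
  ambient norm and the result is carried back to \<open>N\<close> with these constants.\<close>

lemma is_matrix_norm_equiv:
  assumes "is_matrix_norm N"
  obtains K L where "K > 0" "L > 0" "\<And>X. N X \<le> K * norm X" "\<And>X. norm X \<le> L * N X"
proof -
  have eq: "(\<chi> i j. complex_of_real r * X $ i $ j) = r *\<^sub>R X" for r and X :: "complex^'a^'a"
    by (simp add: vec_eq_iff scaleR_conv_of_real[where 'a = complex])
  have "N (r *\<^sub>R X) = \<bar>r\<bar> * N X" for r X
    using assms unfolding is_matrix_norm_def eq[symmetric] by (metis norm_of_real)
  then show ?thesis
    using assms that unfolding is_matrix_norm_def by (rule_tac norm_equiv_euclidean[of N]) auto
qed

lemma sup_norm_upper:
  assumes "is_matrix_norm N" and "bounded (range f)"
  shows "N (f t) \<le> sup_norm N f"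
proof -
  obtain K where K: "K > 0" "\<And>X. N X \<le> K * norm X"
    using is_matrix_norm_equiv[OF assms(1)] by metis
  obtain b where b: "\<And>t. norm (f t) \<le> b"
    using assms(2) by (auto simp: bounded_iff)
  \<comment> \<open>Boundedness of \<open>f\<close> refers to the ambient norm; it has to be
    transferred to \<open>N\<close> before the real supremum is meaningful.\<close>
  have "bdd_above (range (\<lambda>t. N (f t)))"
  proof (rule bdd_aboveI2)
    show "N (f t) \<le> K * b" for t
      using K(2)[of "f t"] mult_left_mono[OF b[of t], of K] K(1) by linarith
  qed
  then show ?thesis
    unfolding sup_norm_def by (intro cSUP_upper) auto
qed

section \<open>Calculus of matrix-valued functions\<close>

lemma bounded_bilinear_matrix_matrix_mult:
  "bounded_bilinear ((**) :: ('a::{euclidean_space,real_normed_algebra_1})^'n^'m \<Rightarrow> 'a^'k^'n \<Rightarrow> _)"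
  unfolding bilinear_conv_bounded_bilinear[symmetric] bilinear_def linear_iff
  by (simp add: matrix_matrix_mult_def vec_eq_iff distrib_left distrib_right sum.distrib
      scaleR_sum_right)

interpretation matrix_mult: bounded_bilinear
  "(**) :: ('a::{euclidean_space,real_normed_algebra_1})^'n^'m \<Rightarrow> 'a^'k^'n \<Rightarrow> _"
  by (rule bounded_bilinear_matrix_matrix_mult)

lemma matrix_inv_right:
  fixes X :: "'a::semiring_1^'n^'m"
  assumes "invertible X"
  shows "X ** matrix_inv X = mat 1"
  using assms someI_ex[of "\<lambda>Y. X ** Y = mat 1 \<and> Y ** X = mat 1"]
  unfolding invertible_def matrix_inv_def by blast

lemma matrix_inv_left:
  fixes X :: "'a::semiring_1^'n^'m"
  assumes "invertible X"
  shows "matrix_inv X ** X = mat 1"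
  using assms someI_ex[of "\<lambda>Y. X ** Y = mat 1 \<and> Y ** X = mat 1"]
  unfolding invertible_def matrix_inv_def by blast

lemma matrix_inv_commute:
  fixes X P :: "'a::semiring_1^'n^'n"
  assumes "invertible X" and "P ** X = X ** P"
  shows "P ** matrix_inv X = matrix_inv X ** P"
proof -
  have "P ** matrix_inv X = matrix_inv X ** (X ** P) ** matrix_inv X"
    by (simp add: matrix_mul_assoc matrix_inv_left assms(1))
  also have "\<dots> = matrix_inv X ** P ** (X ** matrix_inv X)"
    by (simp add: matrix_mul_assoc assms(2)[symmetric])
  finally show ?thesis
    by (simp add: matrix_inv_right assms(1))
qed

text \<open>Cramer's rule, applied to each column of the inverse, makes its entries quotients of
  determinants. Continuity of inversion then reduces to that of polynomials and of division by a
  nonzero number.\<close>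

lemma matrix_inv_cramer:
  fixes X :: "'a::field^'n^'n"
  assumes "invertible X"
  shows "matrix_inv X $ i $ j =
    det (\<chi> k l. if l = i then mat 1 $ k $ j else X $ k $ l) / det X"
proof -
  have "X *v column j (matrix_inv X) = column j (mat 1)"
    using matrix_inv_right[OF assms]
    by (simp add: vec_eq_iff column_def matrix_matrix_mult_def matrix_vector_mult_def)
  moreover have "det X \<noteq> 0"
    using assms invertible_det_nz by blast
  ultimately have "column j (matrix_inv X) =
      (\<chi> m. det (\<chi> k l. if l = m then column j (mat 1) $ k else X $ k $ l) / det X)"
    by (simp add: cramer)
  then show ?thesis
    by (simp add: vec_eq_iff column_def cong: if_cong)
qed

lemma tendsto_det [tendsto_intros]:
  fixes f :: "'b \<Rightarrow> ('a::real_normed_field)^'n^'n"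
  assumes "(f \<longlongrightarrow> X) F"
  shows "((\<lambda>x. det (f x)) \<longlongrightarrow> det X) F"
  unfolding det_def by (intro tendsto_intros assms)

lemma tendsto_matrix_inv:
  fixes f :: "'b \<Rightarrow> ('a::real_normed_field)^'n^'n"
  assumes "(f \<longlongrightarrow> X) F" and "\<And>x. invertible (f x)" and "invertible X"
  shows "((\<lambda>x. matrix_inv (f x)) \<longlongrightarrow> matrix_inv X) F"
proof (intro vec_tendstoI)
  fix i j
  have "((\<lambda>x. if l = i then mat 1 $ k $ j else f x $ k $ l) \<longlongrightarrow>
      (if l = i then mat 1 $ k $ j else X $ k $ l)) F" for k l
    by (auto intro!: tendsto_intros assms(1))
  then show "((\<lambda>x. matrix_inv (f x) $ i $ j) \<longlongrightarrow> matrix_inv X $ i $ j) F"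
    using assms(2,3) unfolding matrix_inv_cramer[OF assms(2)] matrix_inv_cramer[OF assms(3)]
    by (intro tendsto_intros assms(1)) (auto simp: invertible_det_nz)
qed

text \<open>In quotient form a derivative can be computed by limit laws, as is done for the inverse
  below.\<close>

lemma has_vector_derivative_iff_tendsto_quotient:
  "(f has_vector_derivative D) (at x) \<longleftrightarrow>
     ((\<lambda>y. (f y - f x) /\<^sub>R (y - x)) \<longlongrightarrow> D) (at x)"
proof -
  have "norm (f y - f x - (y - x) *\<^sub>R D) / norm (y - x) = norm ((f y - f x) /\<^sub>R (y - x) - D)"
    if "y \<noteq> x" for y
  proof -
    have "(f y - f x) /\<^sub>R (y - x) - D = (f y - f x - (y - x) *\<^sub>R D) /\<^sub>R (y - x)"
      using that by (simp add: scaleR_diff_right)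
    then show ?thesis
      by (simp add: divide_inverse mult.commute)
  qed
  then have "(f has_vector_derivative D) (at x) \<longleftrightarrow>
      ((\<lambda>y. norm ((f y - f x) /\<^sub>R (y - x) - D)) \<longlongrightarrow> 0) (at x)"
    unfolding has_vector_derivative_def has_derivative_iff_norm
    by (simp add: bounded_linear_scaleR_left cong: Lim_cong_within)
  then show ?thesis
    by (simp add: tendsto_norm_zero_iff LIM_zero_iff)
qed

text \<open>The resolvent-type identity Y^-1 - X^-1 = -Y^-1 (Y - X) X^-1 turns the difference
  quotient of the inverse into that of \<open>f\<close> between two inverses, and continuity of
  inversion gives the limit.\<close>

lemma has_vector_derivative_matrix_inv:
  fixes f :: "real \<Rightarrow> ('a::{euclidean_space,real_normed_field})^'n^'n"
  assumes f: "(f has_vector_derivative D) (at x)" and inv: "\<And>y. invertible (f y)"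
  shows "((\<lambda>y. matrix_inv (f y)) has_vector_derivative
    - (matrix_inv (f x) ** D ** matrix_inv (f x))) (at x)"
proof -
  have "matrix_inv (f y) - matrix_inv (f x) =
      - (matrix_inv (f y) ** (f y - f x) ** matrix_inv (f x))" for y
    by (simp add: matrix_mult.diff_left matrix_mult.diff_right matrix_inv_left[OF inv]
        matrix_mul_assoc[symmetric] matrix_inv_right[OF inv])
  then have quot: "(matrix_inv (f y) - matrix_inv (f x)) /\<^sub>R (y - x) =
      - (matrix_inv (f y) ** ((f y - f x) /\<^sub>R (y - x)) ** matrix_inv (f x))" for y
    by (simp add: matrix_mult.scaleR_left matrix_mult.scaleR_right)
  have "(f \<longlongrightarrow> f x) (at x)"
    using f has_vector_derivative_continuous continuous_at by blast
  then show ?thesis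
    using f inv unfolding has_vector_derivative_iff_tendsto_quotient quot
    by (intro tendsto_intros matrix_mult.tendsto tendsto_matrix_inv)
qed

section \<open>Comparison of a transition matrix with its translate\<close>

text \<open>Using \<open>min\<close> and \<open>max\<close> treats both orders of \<open>t\<close>
  and \<open>s\<close> at once. For matrix values the mean value theorem yields only a norm
  inequality, which suffices.\<close>

lemma transition_difference_mvt:
  assumes fund: "fundamental_matrix A \<Phi>"
    and proj: "P ** P = P"
    and comm: "\<And>t. P ** \<Phi> t = \<Phi> t ** P"
    and "t \<noteq> s"
  obtains \<tau> where "min t s < \<tau>" "\<tau> < max t s"
    "norm (transition_matrix \<Phi> (t + \<xi>) (s + \<xi>) ** P - transition_matrix \<Phi> t s ** P) \<le>
       \<bar>t - s\<bar> * norm ((transition_matrix \<Phi> t \<tau> ** P) ** (A (\<tau> + \<xi>) - A \<tau>) **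
         (transition_matrix \<Phi> (\<tau> + \<xi>) (s + \<xi>) ** P))"
proof -
  let ?G = "\<lambda>t. matrix_inv (\<Phi> t)"
  \<comment> \<open>The interpolating product, regrouped so that \<tau> occurs only in the middle
    factor; the outer factors are constants for the product rule.\<close>
  define F where "F \<tau> = (\<Phi> t ** P) ** (?G \<tau> ** \<Phi> (\<tau> + \<xi>)) ** (?G (s + \<xi>) ** P)" for \<tau>
  define F' where "F' \<tau> = (transition_matrix \<Phi> t \<tau> ** P) ** (A (\<tau> + \<xi>) - A \<tau>) **
         (transition_matrix \<Phi> (\<tau> + \<xi>) (s + \<xi>) ** P)" for \<tau>
  have inv: "invertible (\<Phi> \<tau>)" for \<tau>
    using fund by (simp add: fundamental_matrix_def)
  have d\<Phi>: "(\<Phi> has_vector_derivative A \<tau> ** \<Phi> \<tau>) (at \<tau>)" for \<tau>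
    using fund by (simp add: fundamental_matrix_def)
  have PG: "P ** ?G \<tau> = ?G \<tau> ** P" for \<tau>
    using matrix_inv_commute[OF inv comm] .
  have "(F has_vector_derivative F' \<tau>) (at \<tau>)" for \<tau>
  proof -
    have dG: "(?G has_vector_derivative - (?G \<tau> ** A \<tau>)) (at \<tau>)"
      using has_vector_derivative_matrix_inv[OF d\<Phi> inv, of \<tau>]
      by (simp add: matrix_mul_assoc[symmetric] matrix_inv_right[OF inv])
    have "((\<lambda>\<tau>. \<tau> + \<xi>) has_vector_derivative 1) (at \<tau>)"
      by (auto intro!: derivative_eq_intros)
    from vector_diff_chain_at[OF this d\<Phi>]
    have "((\<lambda>\<tau>. \<Phi> (\<tau> + \<xi>)) has_vector_derivative A (\<tau> + \<xi>) ** \<Phi> (\<tau> + \<xi>)) (at \<tau>)"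
      by (simp add: o_def)
    from matrix_mult.has_vector_derivative[OF dG this]
    have "((\<lambda>\<tau>. ?G \<tau> ** \<Phi> (\<tau> + \<xi>)) has_vector_derivative
        ?G \<tau> ** (A (\<tau> + \<xi>) - A \<tau>) ** \<Phi> (\<tau> + \<xi>)) (at \<tau>)"
      by (simp add: matrix_mult.diff_left matrix_mult.diff_right matrix_mult.minus_left
          matrix_mul_assoc)
    then have "(F has_vector_derivative (\<Phi> t ** P) **
        (?G \<tau> ** (A (\<tau> + \<xi>) - A \<tau>) ** \<Phi> (\<tau> + \<xi>)) ** (?G (s + \<xi>) ** P)) (at \<tau>)"
      unfolding F_def
      by (intro bounded_linear.has_vector_derivative[OF matrix_mult.bounded_linear_left]
          bounded_linear.has_vector_derivative[OF matrix_mult.bounded_linear_right])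
    \<comment> \<open>\<open>P\<close> commutes with the inverse of \<Phi> \<tau>, so it can be
      moved to the right of the first transition matrix.\<close>
    moreover have "(\<Phi> t ** P) ** (?G \<tau> ** B ** \<Phi> (\<tau> + \<xi>)) ** (?G (s + \<xi>) ** P) =
        (transition_matrix \<Phi> t \<tau> ** P) ** B ** (transition_matrix \<Phi> (\<tau> + \<xi>) (s + \<xi>) ** P)" for B
    proof -
      have "\<Phi> t ** P ** ?G \<tau> = \<Phi> t ** ?G \<tau> ** P"
        by (metis PG matrix_mul_assoc)
      then show ?thesis
        by (simp add: transition_matrix_def matrix_mul_assoc)
    qed
    ultimately show ?thesis
      by (simp add: F'_def)
  qed
  then have der: "(F has_derivative (\<lambda>h. h *\<^sub>R F' \<tau>)) (at \<tau>)" for \<tau>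
    by (simp add: has_vector_derivative_def)
  then have cont: "continuous_on S F" for S
    by (meson continuous_at_imp_continuous_on has_derivative_continuous)
  obtain \<tau> where \<tau>: "min t s < \<tau>" "\<tau> < max t s"
    "norm (F (max t s) - F (min t s)) \<le> norm ((max t s - min t s) *\<^sub>R F' \<tau>)"
    using mvt_general[OF _ cont der, of "min t s" "max t s"] \<open>t \<noteq> s\<close> by fastforce
  \<comment> \<open>At each endpoint one pair \<Phi>, \<Phi>^-1 cancels, and the two copies of
    \<open>P\<close> meet and merge by idempotence.\<close>
  have "F t = P ** (\<Phi> t ** ?G t) ** \<Phi> (t + \<xi>) ** ?G (s + \<xi>) ** P"
    by (simp add: F_def matrix_mul_assoc comm)
  also have "\<dots> = \<Phi> (t + \<xi>) ** (P ** ?G (s + \<xi>)) ** P"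
    by (simp add: matrix_inv_right[OF inv] matrix_mul_assoc comm)
  also have "\<dots> = transition_matrix \<Phi> (t + \<xi>) (s + \<xi>) ** (P ** P)"
    by (simp add: PG transition_matrix_def matrix_mul_assoc)
  finally have Ft: "F t = transition_matrix \<Phi> (t + \<xi>) (s + \<xi>) ** P"
    by (simp add: proj)
  have "F s = \<Phi> t ** P ** ?G s ** (\<Phi> (s + \<xi>) ** ?G (s + \<xi>)) ** P"
    by (simp add: F_def matrix_mul_assoc)
  also have "\<dots> = \<Phi> t ** (P ** ?G s) ** P"
    by (simp add: matrix_inv_right[OF inv] matrix_mul_assoc)
  also have "\<dots> = transition_matrix \<Phi> t s ** (P ** P)"
    by (simp add: PG transition_matrix_def matrix_mul_assoc)
  finally have Fs: "F s = transition_matrix \<Phi> t s ** P"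
    by (simp add: proj)
  have "norm (F t - F s) \<le> \<bar>t - s\<bar> * norm (F' \<tau>)"
    using \<tau>(3) by (auto simp: min_def max_def norm_minus_commute abs_if split: if_splits)
  then show ?thesis
    using that \<tau>(1,2) unfolding Ft Fs F'_def by blast
qed

text \<open>Half of the decay rate absorbs the linear factor, because u \<le> exp u for u = \<alpha>
  x / 2.\<close>

lemma mult_exp_neg_le:
  fixes \<alpha> x :: real
  assumes "\<alpha> > 0"
  shows "x * exp (- \<alpha> * x) \<le> 2 / \<alpha> * exp (- (\<alpha> / 2) * x)"
proof -
  have "\<alpha> / 2 * x \<le> exp (\<alpha> / 2 * x)"
    using exp_ge_add_one_self[of "\<alpha> / 2 * x"] by linarith
  then have "\<alpha> / 2 * x * exp (- \<alpha> * x) \<le> exp (\<alpha> / 2 * x) * exp (- \<alpha> * x)"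
    by (rule mult_right_mono) simp
  also have "\<dots> = exp (- (\<alpha> / 2) * x)"
    by (simp add: exp_add[symmetric])
  finally show ?thesis
    using assms by (simp add: field_simps)
qed

theorem lemma2p7:
  fixes N :: "complex^'p^'p \<Rightarrow> real"
    and A \<Phi> :: "real \<Rightarrow> complex^'p^'p"
    and P :: "complex^'p^'p"
    and c \<alpha> :: real
    and D :: "(real \<times> real) set"
  assumes "is_matrix_norm N"
    and "almost_periodic N A"
    and "fundamental_matrix A \<Phi>"
    and "P ** P = P"
    and "\<And>t. P ** \<Phi> t = \<Phi> t ** P"
    and "c > 0" and "\<alpha> > 0"
    and "D = {(t, s). t > s} \<or> D = {(t, s). t < s}"
    and "\<forall>(t, s)\<in>D. N (transition_matrix \<Phi> t s ** P) \<le> c * exp (- \<alpha> * \<bar>t - s\<bar>)"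
  shows "\<exists>c1 \<alpha>'. c1 > 0 \<and> 0 < \<alpha>' \<and> \<alpha>' < \<alpha> \<and>
    (\<forall>(t, s)\<in>D. \<forall>\<xi>.
       N (transition_matrix \<Phi> (t + \<xi>) (s + \<xi>) ** P - transition_matrix \<Phi> t s ** P)
         \<le> c1 * sup_norm N (\<lambda>u. A (u + \<xi>) - A u) * exp (- \<alpha>' * \<bar>t - s\<bar>)) \<and>
    bi_almost_periodic N A D c1 \<alpha>' (\<lambda>t s. transition_matrix \<Phi> t s ** P)"
proof -
  let ?\<Psi> = "\<lambda>t s. transition_matrix \<Phi> t s ** P"
  obtain K L where KL: "K > 0" "L > 0" and N_le: "\<And>X. N X \<le> K * norm X"
    and norm_le: "\<And>X. norm X \<le> L * N X"
    using is_matrix_norm_equiv[OF assms(1)] by metis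
  obtain b where b: "b > 0"
    and mult_le: "\<And>(X :: complex^'p^'p) (Y :: complex^'p^'p). norm (X ** Y) \<le> norm X * norm Y * b"
    using matrix_mult.pos_bounded by metis
  have triple_le: "norm (X ** Y ** Z) \<le> norm X * norm Y * b * norm Z * b"
    for X Y Z :: "complex^'p^'p"
    using mult_le[of "X ** Y" Z] mult_right_mono[OF mult_le[of X Y], where c = "norm Z * b"] b
    by (simp add: mult.assoc)
  \<comment> \<open>\<open>K\<close> and the three factors \<open>L\<close> come from changing
    norms, the two factors \<open>b\<close> from the two matrix products, and the two factors
    \<open>c\<close> from using the hypothesis twice.\<close>
  define C where "C = K * b\<^sup>2 * L ^ 3 * c\<^sup>2"
  have C: "C > 0"
    unfolding C_def using KL b assms(6) by simp
  \<comment> \<open>A general bound \<open>M\<close> serves both conclusions: it is later the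
    supremum norm and then \<epsilon>.\<close>
  have main: "N (?\<Psi> (t + \<xi>) (s + \<xi>) - ?\<Psi> t s) \<le> C * (2 / \<alpha>) * M * exp (- (\<alpha> / 2) * \<bar>t - s\<bar>)"
    if D: "(t, s) \<in> D" and M: "\<And>u. N (A (u + \<xi>) - A u) \<le> M" for t s \<xi> M
  proof -
    have "t \<noteq> s"
      using D assms(8) by auto
    then obtain \<tau> where \<tau>: "min t s < \<tau>" "\<tau> < max t s"
      and le: "norm (?\<Psi> (t + \<xi>) (s + \<xi>) - ?\<Psi> t s) \<le>
        \<bar>t - s\<bar> * norm (?\<Psi> t \<tau> ** (A (\<tau> + \<xi>) - A \<tau>) ** ?\<Psi> (\<tau> + \<xi>) (s + \<xi>))"
      using transition_difference_mvt[OF assms(3-5)] by metis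
    \<comment> \<open>As \<tau> lies strictly between \<open>s\<close> and \<open>t\<close>, both
      pairs are ordered like (t, s), and \<open>D\<close> is invariant under diagonal
      translation.\<close>
    have inD: "(t, \<tau>) \<in> D" "(\<tau> + \<xi>, s + \<xi>) \<in> D"
      using D assms(8) \<tau> by auto
    let ?e1 = "exp (- \<alpha> * \<bar>t - \<tau>\<bar>)" and ?e2 = "exp (- \<alpha> * \<bar>\<tau> - s\<bar>)"
    have n1: "norm (?\<Psi> t \<tau>) \<le> L * (c * ?e1)"
      by (rule order_trans[OF norm_le]) (use assms(9) inD(1) KL in \<open>auto intro!: mult_left_mono\<close>)
    have n2: "norm (?\<Psi> (\<tau> + \<xi>) (s + \<xi>)) \<le> L * (c * ?e2)"
      by (rule order_trans[OF norm_le])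
        (use assms(9) inD(2) KL in \<open>force intro!: mult_left_mono\<close>)
    have n3: "norm (A (\<tau> + \<xi>) - A \<tau>) \<le> L * M"
      by (rule order_trans[OF norm_le]) (use M KL in \<open>auto intro!: mult_left_mono\<close>)
    have M0: "0 \<le> M"
      using order_trans[OF norm_ge_zero n3] KL(2) by (simp add: zero_le_mult_iff)
    \<comment> \<open>Distances add up at an intermediate point, so the two decay factors multiply
      to one that is independent of \<tau>.\<close>
    have "\<bar>t - \<tau>\<bar> + \<bar>\<tau> - s\<bar> = \<bar>t - s\<bar>"
      using \<tau> by (auto simp: min_def max_def split: if_splits)
    then have exp: "?e1 * ?e2 = exp (- \<alpha> * \<bar>t - s\<bar>)"
      by (metis exp_add distrib_left)
    have "norm (?\<Psi> t \<tau> ** (A (\<tau> + \<xi>) - A \<tau>) ** ?\<Psi> (\<tau> + \<xi>) (s + \<xi>)) \<le>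
        norm (?\<Psi> t \<tau>) * norm (A (\<tau> + \<xi>) - A \<tau>) * b * norm (?\<Psi> (\<tau> + \<xi>) (s + \<xi>)) * b"
      by (rule triple_le)
    also have "\<dots> \<le> (L * (c * ?e1)) * (L * M) * b * (L * (c * ?e2)) * b"
      using n1 n2 n3 M0 b KL assms(6) by (intro mult_mono mult_nonneg_nonneg) auto
    also have "\<dots> = b\<^sup>2 * L ^ 3 * c\<^sup>2 * M * (?e1 * ?e2)"
      by (simp add: power2_eq_square power3_eq_cube mult_ac)
    finally have "N (?\<Psi> (t + \<xi>) (s + \<xi>) - ?\<Psi> t s) \<le>
        K * (\<bar>t - s\<bar> * (b\<^sup>2 * L ^ 3 * c\<^sup>2 * M * exp (- \<alpha> * \<bar>t - s\<bar>)))"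
      unfolding exp using KL
      by (intro order_trans[OF N_le] mult_left_mono order_trans[OF le]) auto
    also have "\<dots> = C * M * (\<bar>t - s\<bar> * exp (- \<alpha> * \<bar>t - s\<bar>))"
      by (simp add: C_def mult_ac)
    also have "\<dots> \<le> C * M * (2 / \<alpha> * exp (- (\<alpha> / 2) * \<bar>t - s\<bar>))"
      using C M0 mult_exp_neg_le[OF assms(7)] by (intro mult_left_mono) auto
    finally show ?thesis
      by (simp add: mult_ac)
  qed
  \<comment> \<open>This ensures that the supremum norm of the difference really dominates its
    values.\<close>
  have bdd: "bounded (range (\<lambda>u. A (u + \<xi>) - A u))" for \<xi>
  proof -
    have "bounded (range A)"
      using assms(2) by (simp add: almost_periodic_def)
    then show ?thesis
      by (intro bounded_minus_comp) (auto intro: bounded_subset)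
  qed
  show ?thesis
  proof (rule exI[of _ "C * (2 / \<alpha>)"], rule exI[of _ "\<alpha> / 2"], intro conjI)
    show "\<forall>(t, s)\<in>D. \<forall>\<xi>. N (?\<Psi> (t + \<xi>) (s + \<xi>) - ?\<Psi> t s) \<le>
        C * (2 / \<alpha>) * sup_norm N (\<lambda>u. A (u + \<xi>) - A u) * exp (- (\<alpha> / 2) * \<bar>t - s\<bar>)"
      using main sup_norm_upper[OF assms(1) bdd] by blast
    show "bi_almost_periodic N A D (C * (2 / \<alpha>)) (\<alpha> / 2) ?\<Psi>"
      unfolding bi_almost_periodic_def almost_period_def using main by blast
  qed (use C assms(7) in auto)
qed

end
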